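(* Let $B$ be a separable Banach space with norm $\|\cdot\|_B$. Let $G:B\to B$ be a function such that the equation $G(x)=0$ has a unique solution $x^*\in B$, and suppose there are constants $0<\rho<1$ and $1\le\theta<\infty$ with $$\|\theta^{-1}G(x)-(x-x^* )\|_B\le\rho\|x-x^*\|_B\quad\text{for all }x\in B.$$ Let $\{\alpha_n:n\ge 0\}$ be a sequence of constants in $(0,1)$ with $\lim_n\alpha_n=0$, $\sum_{n=0}^\infty\alpha_n=\infty$ and $\sum_{n=0}^\infty\alpha_n^2<\infty$. Let $\{Z_n:n\ge 0\}$ be a sequence of independent identically distributed $B$-valued Gaussian random variables on a probability space $(\Omega,\mathcal F,\mathbb P)$. Fix $x_0\in B$ and define $X_0=x_0$ and $$X_{n+1}=X_n-\alpha_n\bigl(G(X_n)+Z_{n+1}\bigr),\quad n\ge 0.$$ Then $\{X_{n+1}:n\ge 0\}$ converges to $x^*$ almost surely.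
   Context: A $B$-valued random variable $Z$ is Gaussian if $L(Z)$ is a (possibly degenerate) real Gaussian random variable for every continuous linear functional $L\in B^*$. Convergence is in the norm $\|\cdot\|_B$.
   Formalization: The Gaussian variables Z_n are additionally assumed centered (E L(Z_n) = 0 for every continuous linear functional L); without this the claim fails, e.g. B = ℝ, G(x) = x, Z_n = c ≠ 0, α_n = 1/(n+2) gives X_n → -c. *)

theory Defs
  imports "HOL-Probability.Probability"
begin

text \<open>The first disjunct is the degenerate case of variance zero. The mean is arbitrary here.\<close>

definition real_gaussian :: "'w measure \<Rightarrow> ('w \<Rightarrow> real) \<Rightarrow> bool" where
  "real_gaussian M Y \<longleftrightarrow> Y \<in> borel_measurable M \<and>
     ((\<exists>\<mu>. AE \<omega> in M. Y \<omega> = \<mu>) \<or>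
      (\<exists>\<mu> \<sigma>. 0 < \<sigma> \<and> distributed M lborel Y (normal_density \<mu> \<sigma>)))"

definition gaussian_rv :: "'w measure \<Rightarrow> ('w \<Rightarrow> 'b::{banach, second_countable_topology}) \<Rightarrow> bool" where
  "gaussian_rv M Z \<longleftrightarrow> Z \<in> borel_measurable M \<and>
     (\<forall>L :: 'b \<Rightarrow> real. bounded_linear L \<longrightarrow> real_gaussian M (\<lambda>\<omega>. L (Z \<omega>)))"

end

(* The path is compared with the partial sums S n of the noise series: if S n converges to T, then
   D n = X n - xstar + S n - T satisfies
     norm (D (n + 1)) <= (1 - (1 - rho) theta alpha_n) norm (D n) + (1 + rho) theta alpha_n norm (S n - T)
   for large n and hence tends to 0, because sum alpha_n = infinity.

   The noise series converges almost surely because a finite sum of alpha_k Z_(k+1) has a norm distributed as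
   sqrt (sum alpha_k^2) norm (Z_0), so the series is Cauchy in probability; Ottaviani's inequality upgrades this to
   almost sure convergence.  To identify the law of the norm, the Hahn-Banach theorem gives a countable
   norming family of functionals, and the characteristic functional determines the probability of
   {|L_1| <= t, ..., |L_n| <= t} by induction on n. *)

theory Submission imports Defs begin

section \<open>Pathwise stability\<close>

text \<open>Once \<open>e n\<close> is below r / 2, the excess \<open>d n - r / 2\<close> shrinks by
  the factor \<open>1 - b n\<close> at every step. Divergence of the sum of the \<open>b n\<close>
  forces the product of these factors to 0.\<close>

lemma damped_recursion_tendsto_zero:
  fixes d b e :: "nat \<Rightarrow> real"
  assumes d: "\<And>n. 0 \<le> d n"
    and b: "eventually (\<lambda>n. 0 \<le> b n \<and> b n \<le> 1) sequentially"
    and div: "filterlim (\<lambda>n. \<Sum>k<n. b k) at_top sequentially"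
    and e: "e \<longlonglongrightarrow> 0"
    and rec: "eventually (\<lambda>n. d (Suc n) \<le> (1 - b n) * d n + b n * e n) sequentially"
  shows "d \<longlonglongrightarrow> 0"
proof (rule LIMSEQ_I)
  fix r :: real assume r: "0 < r"
  then have "eventually (\<lambda>n. e n < r / 2) sequentially"
    using order_tendstoD(2)[OF e, of "r / 2"] by simp
  then have "eventually (\<lambda>n. 0 \<le> b n \<and> b n \<le> 1 \<and> e n < r / 2 \<and>
      d (Suc n) \<le> (1 - b n) * d n + b n * e n) sequentially"
    using b rec by eventually_elim simp
  then obtain N where N: "\<And>n. n \<ge> N \<Longrightarrow> 0 \<le> b n \<and> b n \<le> 1 \<and> e n < r / 2 \<and>
      d (Suc n) \<le> (1 - b n) * d n + b n * e n"
    by (auto simp: eventually_sequentially)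
  define S where "S n = (\<Sum>k<n. b k)" for n
  \<comment> \<open>By 1 - b <= exp (- b), the exponential of a difference of partial sums replaces
    the product of the factors \<open>1 - b k\<close>.\<close>
  have bound: "d n - r / 2 \<le> exp (S N - S n) * d N" if "n \<ge> N" for n
    using that
  proof (induction n rule: dec_induct)
    case base then show ?case using r by simp
  next
    case (step n)
    have "b n * e n \<le> b n * (r / 2)"
      using N[OF step(1)] by (intro mult_left_mono) auto
    moreover have "d (Suc n) \<le> (1 - b n) * d n + b n * e n"
      using N[OF step(1)] by simp
    moreover have "(1 - b n) * (d n - r / 2) = (1 - b n) * d n + b n * (r / 2) - r / 2"
      by (simp add: field_simps)
    ultimately have "d (Suc n) - r / 2 \<le> (1 - b n) * (d n - r / 2)"
      by linarith
    also have "\<dots> \<le> (1 - b n) * (exp (S N - S n) * d N)"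
      using N[OF step(1)] step.IH by (intro mult_left_mono) auto
    also have "\<dots> \<le> exp (- b n) * (exp (S N - S n) * d N)"
      using d exp_ge_add_one_self[of "- b n"] by (intro mult_right_mono) auto
    also have "\<dots> = exp (S N - S (Suc n)) * d N"
      by (simp add: S_def algebra_simps flip: exp_add)
    finally show ?case .
  qed
  have "filterlim (\<lambda>n. - S N + S n) at_top sequentially"
    using div unfolding S_def by (intro filterlim_tendsto_add_at_top tendsto_const) auto
  then have "filterlim (\<lambda>n. S N - S n) at_bot sequentially"
    by (simp add: filterlim_uminus_at_top)
  then have "(\<lambda>n. exp (S N - S n)) \<longlonglongrightarrow> 0"
    by (rule filterlim_compose[OF exp_at_bot])
  then have "(\<lambda>n. exp (S N - S n) * d N) \<longlonglongrightarrow> 0"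
    by (rule tendsto_mult_left_zero)
  then have "eventually (\<lambda>n. exp (S N - S n) * d N < r / 2) sequentially"
    using r by (intro order_tendstoD(2)) auto
  then have "eventually (\<lambda>n. norm (d n - 0) < r) sequentially"
    using eventually_ge_at_top[of N]
  proof eventually_elim
    case (elim n) then show ?case using bound[of n] d[of n] by simp
  qed
  then show "\<exists>no. \<forall>n\<ge>no. norm (d n - 0) < r" by (simp add: eventually_sequentially)
qed

lemma stochastic_approximation_path:
  fixes G :: "'b::real_normed_vector \<Rightarrow> 'b" and x z :: "nat \<Rightarrow> 'b"
  assumes \<rho>: "0 \<le> \<rho>" "\<rho> < 1" and \<theta>: "0 < \<theta>"
    and G: "\<And>x. norm (inverse \<theta> *\<^sub>R G x - (x - xstar)) \<le> \<rho> * norm (x - xstar)"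
    and \<alpha>: "\<And>n. 0 < \<alpha> n" "\<alpha> \<longlonglongrightarrow> 0"
    and div: "filterlim (\<lambda>N. \<Sum>n<N. \<alpha> n) at_top sequentially"
    and rec: "\<And>n. x (Suc n) = x n - \<alpha> n *\<^sub>R (G (x n) + z n)"
    and conv: "convergent (\<lambda>n. \<Sum>k<n. \<alpha> k *\<^sub>R z k)"
  shows "x \<longlonglongrightarrow> xstar"
proof -
  obtain T where T: "(\<lambda>n. \<Sum>k<n. \<alpha> k *\<^sub>R z k) \<longlonglongrightarrow> T"
    using conv by (auto simp: convergent_def)
  define s where "s n = (\<Sum>k<n. \<alpha> k *\<^sub>R z k) - T" for n
  have s: "s \<longlonglongrightarrow> 0"
    using tendsto_diff[OF T tendsto_const[of T]] by (simp add: s_def [abs_def])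
  \<comment> \<open>Adding \<open>s n\<close> removes the noise: its increment
    \<open>\<alpha> n *\<^sub>R z n\<close> cancels the noise term of the recursion. Only the null
    sequence \<open>s n\<close> is left as a perturbation.\<close>
  define D where "D n = (x n - xstar) + s n" for n
  define r where "r n = inverse \<theta> *\<^sub>R G (x n) - (x n - xstar)" for n
  define a where "a n = \<theta> * \<alpha> n" for n
  have a_pos: "0 < a n" for n using \<alpha> \<theta> by (simp add: a_def)
  \<comment> \<open>Since \<open>\<theta>\<close> may exceed 1, \<open>a n\<close> is at most 1 only
    from some index on. From there \<open>1 - a n\<close> is a nonnegative factor and comes out of
    the norm unchanged.\<close>
  have a_le: "eventually (\<lambda>n. a n \<le> 1) sequentially"
  proof -
    have "a \<longlonglongrightarrow> 0" unfolding a_def using tendsto_mult_right_zero[OF \<alpha>(2)] .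
    then have "eventually (\<lambda>n. a n < 1) sequentially" by (rule order_tendstoD) simp
    then show ?thesis by eventually_elim simp
  qed
  have step: "D (Suc n) = (1 - a n) *\<^sub>R D n + a n *\<^sub>R (s n - r n)" for n
  proof -
    have "\<alpha> n *\<^sub>R G (x n) = a n *\<^sub>R (x n - xstar + r n)"
      using \<theta> by (simp add: a_def r_def)
    then show ?thesis
      by (simp add: D_def s_def rec algebra_simps)
  qed
  have r: "norm (r n) \<le> \<rho> * (norm (D n) + norm (s n))" for n
  proof -
    have "norm (r n) \<le> \<rho> * norm (x n - xstar)" using G by (simp add: r_def)
    also have "norm (x n - xstar) \<le> norm (D n) + norm (s n)"
      using norm_triangle_ineq4[of "D n" "s n"] by (simp add: D_def)
    finally show ?thesis using \<rho>(1) by (simp add: mult_left_mono)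
  qed
  have "(\<lambda>n. norm (D n)) \<longlonglongrightarrow> 0"
  proof (rule damped_recursion_tendsto_zero)
    show "eventually (\<lambda>n. 0 \<le> (1 - \<rho>) * a n \<and> (1 - \<rho>) * a n \<le> 1) sequentially"
      using a_le
    proof eventually_elim
      case (elim n)
      then have "(1 - \<rho>) * a n \<le> 1 * 1"
        using \<rho> a_pos[of n] by (intro mult_mono) auto
      then show ?case using \<rho> a_pos[of n] by simp
    qed
    have "filterlim (\<lambda>n. ((1 - \<rho>) * \<theta>) * (\<Sum>k<n. \<alpha> k)) at_top sequentially"
      using \<rho> \<theta> by (intro filterlim_tendsto_pos_mult_at_top[OF tendsto_const _ div]) simp
    then show "filterlim (\<lambda>n. \<Sum>k<n. (1 - \<rho>) * a k) at_top sequentially"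
      by (simp add: a_def sum_distrib_left mult.assoc)
    \<comment> \<open>The triangle inequality leaves the error (1 + \<rho>) * a n * norm (s n).
      Dividing it by the damping coefficient (1 - \<rho>) * a n gives this null sequence.\<close>
    show "(\<lambda>n. (1 + \<rho>) / (1 - \<rho>) * norm (s n)) \<longlonglongrightarrow> 0"
      using tendsto_mult_right_zero[OF tendsto_norm_zero[OF s]] .
    show "eventually (\<lambda>n. norm (D (Suc n)) \<le> (1 - (1 - \<rho>) * a n) * norm (D n) +
        (1 - \<rho>) * a n * ((1 + \<rho>) / (1 - \<rho>) * norm (s n))) sequentially"
      using a_le
    proof eventually_elim
      case (elim n)
      have "norm (D (Suc n)) \<le> norm ((1 - a n) *\<^sub>R D n) + norm (a n *\<^sub>R (s n - r n))"
        unfolding step by (rule norm_triangle_ineq)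
      also have "\<dots> = (1 - a n) * norm (D n) + a n * norm (s n - r n)"
        using elim a_pos[of n] by simp
      also have "\<dots> \<le> (1 - a n) * norm (D n) + a n * (norm (s n) + \<rho> * (norm (D n) + norm (s n)))"
        using a_pos[of n] r[of n] norm_triangle_ineq4[of "s n" "r n"]
        by (intro add_left_mono mult_left_mono) auto
      also have "\<dots> = (1 - (1 - \<rho>) * a n) * norm (D n) +
        (1 - \<rho>) * a n * ((1 + \<rho>) / (1 - \<rho>) * norm (s n))"
        using \<rho> by (simp add: field_simps)
      finally show ?case .
    qed
  qed simp
  then have "D \<longlonglongrightarrow> 0" by (rule tendsto_norm_zero_cancel)
  then have "(\<lambda>n. D n - s n + xstar) \<longlonglongrightarrow> 0 - 0 + xstar"
    using s by (intro tendsto_intros)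
  then show ?thesis by (simp add: D_def)
qed

section \<open>Norming functionals\<close>

definition sublinear :: "('b::real_vector \<Rightarrow> real) \<Rightarrow> bool" where
  "sublinear p \<longleftrightarrow> (\<forall>x y. p (x + y) \<le> p x + p y) \<and> (\<forall>t>0. \<forall>x. p (t *\<^sub>R x) = t * p x)"

lemma sublinear_add: "sublinear p \<Longrightarrow> p (x + y) \<le> p x + p y"
  by (simp add: sublinear_def)

lemma sublinear_zero [simp]:
  assumes "sublinear p" shows "p 0 = 0"
proof -
  have "p (2 *\<^sub>R 0) = 2 * p 0"
    using assms unfolding sublinear_def by (metis zero_less_numeral)
  then show ?thesis by simp
qed

lemma sublinear_scale: "sublinear p \<Longrightarrow> 0 \<le> t \<Longrightarrow> p (t *\<^sub>R x) = t * p x"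
  by (cases "t = 0") (auto simp: sublinear_def)

lemma sublinear_minus_ge: "sublinear p \<Longrightarrow> - p (- x) \<le> p x"
  using sublinear_add[of p x "- x"] by simp

text \<open>The infimum of p (x + t y) - t p y over t >= 0 pushes \<open>p\<close> down until it is
  odd at \<open>y\<close>: t = 0 gives \<open>q \<le> p\<close>, and t = 1 at \<open>- y\<close>
  gives the last bound. Subadditivity keeps the infimum above \<open>- p (- x)\<close>, so it is
  finite.\<close>

lemma sublinear_directional:
  assumes p: "sublinear p"
  obtains q where "sublinear q" "\<And>x. q x \<le> p x" "q (- y) \<le> - p y"
proof
  define h where "h x t = p (x + t *\<^sub>R y) - t * p y" for x and t :: real
  define q where "q x = (INF t\<in>{0..}. h x t)" for x
  have h_ge: "- p (- x) \<le> h x t" if "0 \<le> t" for x t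
    using sublinear_add[OF p, of "- x" "x + t *\<^sub>R y"] sublinear_scale[OF p that, of y]
    by (simp add: h_def)
  have q_le: "q x \<le> h x t" if "0 \<le> t" for x t
    unfolding q_def using that h_ge by (intro cINF_lower bdd_belowI2[of _ "- p (- x)"]) auto
  have q_ge: "c \<le> q x" if "\<And>t. 0 \<le> t \<Longrightarrow> c \<le> h x t" for c x
    unfolding q_def using that by (intro cINF_greatest) auto
  show "q x \<le> p x" for x
    using q_le[of 0 x] by (simp add: h_def)
  show "q (- y) \<le> - p y"
    using q_le[of 1 "- y"] p by (simp add: h_def)
  have add: "q (x + x') \<le> q x + q x'" for x x'
  proof -
    have "q (x + x') \<le> h x t + h x' s" if "0 \<le> t" "0 \<le> s" for t s
    proof -
      \<comment> \<open>The parameter t + s splits the argument as (x + t y) + (x' + s y), so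
        independently chosen t and s suffice.\<close>
      have "q (x + x') \<le> h (x + x') (t + s)" using that by (intro q_le) simp
      also have "\<dots> \<le> h x t + h x' s"
        using sublinear_add[OF p, of "x + t *\<^sub>R y" "x' + s *\<^sub>R y"]
        by (simp add: h_def algebra_simps)
      finally show ?thesis .
    qed
    then have "q (x + x') - h x t \<le> q x'" if "0 \<le> t" for t
      using that by (intro q_ge) (simp add: algebra_simps)
    then have "q (x + x') - q x' \<le> q x"
      by (intro q_ge) (simp add: algebra_simps)
    then show ?thesis by simp
  qed
  have scale_le: "q (c *\<^sub>R x) \<le> c * q x" if "0 < c" for c x
  proof -
    have "q (c *\<^sub>R x) / c \<le> h x t" if "0 \<le> t" for t
    proof -
      have "q (c *\<^sub>R x) \<le> h (c *\<^sub>R x) (c * t)"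
        using that \<open>0 < c\<close> by (intro q_le) simp
      also have "\<dots> = c * h x t"
        using sublinear_scale[OF p, of c "x + t *\<^sub>R y"] \<open>0 < c\<close>
        by (simp add: h_def algebra_simps)
      finally show ?thesis using \<open>0 < c\<close> by (simp add: field_simps)
    qed
    then have "q (c *\<^sub>R x) / c \<le> q x" by (rule q_ge)
    then show ?thesis using that by (simp add: field_simps)
  qed
  \<comment> \<open>The reverse inequality is \<open>scale_le\<close> for the factor 1 / c at the
    vector c x.\<close>
  have "q (c *\<^sub>R x) = c * q x" if "0 < c" for c x
  proof (rule antisym[OF scale_le[OF that]])
    have "q (inverse c *\<^sub>R (c *\<^sub>R x)) \<le> inverse c * q (c *\<^sub>R x)"
      using that by (intro scale_le) simp
    then show "c * q x \<le> q (c *\<^sub>R x)" using that by (simp add: field_simps)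
  qed
  with add show "sublinear q" by (simp add: sublinear_def)
qed

text \<open>The lower bound for Zorn's lemma. Every member satisfies q x >= - q (- x) >= - p (- x),
  so the pointwise infimum is finite. It is subadditive because the smaller of two comparable
  members serves both arguments at once.\<close>

lemma sublinear_chain_Inf:
  assumes C: "C \<noteq> {}" "\<And>q. q \<in> C \<Longrightarrow> sublinear q" "\<And>q x. q \<in> C \<Longrightarrow> q x \<le> p x"
    and chain: "\<And>q r. q \<in> C \<Longrightarrow> r \<in> C \<Longrightarrow> q \<le> r \<or> r \<le> q"
  obtains u where "sublinear u" "\<And>q x. q \<in> C \<Longrightarrow> u x \<le> q x"
proof
  define u where "u x = (INF q\<in>C. q x)" for x
  have bdd: "- p (- x) \<le> q x" if "q \<in> C" for q x
    using sublinear_minus_ge[OF C(2)[OF that], of x] C(3)[OF that, of "- x"] by simp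
  have u_le: "u x \<le> q x" if "q \<in> C" for q x
    unfolding u_def using that bdd by (intro cINF_lower bdd_belowI2[of _ "- p (- x)"]) auto
  have u_ge: "c \<le> u x" if "\<And>q. q \<in> C \<Longrightarrow> c \<le> q x" for c x
    unfolding u_def using that C(1) by (intro cINF_greatest) auto
  show "u x \<le> q x" if "q \<in> C" for q x using u_le[OF that] .
  have add: "u (x + y) \<le> u x + u y" for x y
  proof -
    have pair: "u (x + y) \<le> q x + r y" if "q \<in> C" "r \<in> C" for q r
    proof -
      from chain[OF that] that obtain s where s: "s \<in> C" "s x \<le> q x" "s y \<le> r y"
        by (metis le_fun_def order_refl)
      then show ?thesis
        using u_le[OF s(1), of "x + y"] sublinear_add[OF C(2)[OF s(1)], of x y] by simp
    qed
    have "u (x + y) - q x \<le> u y" if "q \<in> C" for q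
      using pair[OF that] by (intro u_ge) (simp add: diff_le_eq add.commute)
    then have "u (x + y) - u y \<le> u x"
      by (intro u_ge) (simp add: algebra_simps)
    then show ?thesis by simp
  qed
  have scale_le: "c * u x \<le> u (c *\<^sub>R x)" if "0 < c" for c x
  proof (rule u_ge)
    fix q assume "q \<in> C"
    then show "c * u x \<le> q (c *\<^sub>R x)"
      using u_le[of q x] sublinear_scale[OF C(2), of q c x] that by simp
  qed
  have "u (c *\<^sub>R x) = c * u x" if "0 < c" for c x
  proof (rule antisym[OF _ scale_le[OF that]])
    have "inverse c * u (c *\<^sub>R x) \<le> u (inverse c *\<^sub>R (c *\<^sub>R x))"
      using that by (intro scale_le) simp
    then show "u (c *\<^sub>R x) \<le> c * u x" using that by (simp add: field_simps)
  qed
  with add show "sublinear u" by (simp add: sublinear_def)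
qed

text \<open>By minimality the directional infimum coincides with \<open>p\<close>, so
  \<open>p\<close> is odd. For an odd functional, subadditivity applied to x + y and - y yields the
  reverse inequality.\<close>

lemma sublinear_minimal_linear:
  assumes p: "sublinear p"
    and min: "\<And>q. sublinear q \<Longrightarrow> (\<And>x. q x \<le> p x) \<Longrightarrow> q = p"
  shows "linear p"
proof
  have minus: "p (- y) = - p y" for y
  proof -
    obtain q where "sublinear q" "\<And>x. q x \<le> p x" "q (- y) \<le> - p y"
      using sublinear_directional[OF p] by metis
    with min[of q] have "p (- y) \<le> - p y" by simp
    then show ?thesis using sublinear_minus_ge[OF p, of y] by simp
  qed
  show "p (x + y) = p x + p y" for x y
    using sublinear_add[OF p, of x y] sublinear_add[OF p, of "x + y" "- y"] minus[of y] by simp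
  show "p (c *\<^sub>R x) = c *\<^sub>R p x" for c x
  proof (cases "0 \<le> c")
    case True then show ?thesis by (simp add: sublinear_scale[OF p])
  next
    case False
    then have "p ((- c) *\<^sub>R x) = (- c) * p x" by (intro sublinear_scale[OF p]) simp
    then show ?thesis using minus[of "c *\<^sub>R x"] by simp
  qed
qed

text \<open>Zorn's lemma is applied to the sublinear functionals below \<open>p\<close> themselves rather than to
  partial linear functionals: a minimal one is linear.\<close>

theorem Hahn_Banach_sublinear:
  assumes p: "sublinear p"
  obtains L where "linear L" "\<And>x. L x \<le> p x"
proof -
  define A where "A = {q. sublinear q \<and> q \<le> p}"
  \<comment> \<open>The order is reversed, so a maximal element for \<open>P\<close> is a minimal
    sublinear functional.\<close>
  define P where "P q r \<longleftrightarrow> r \<le> q" for q r :: "'a \<Rightarrow> real"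
  have "\<exists>m\<in>A. \<forall>a\<in>A. P m a \<longrightarrow> a = m"
  proof (rule predicate_Zorn)
    show "partial_order_on A (relation_of P A)"
      by (rule partial_order_on_relation_ofI) (auto simp: P_def)
    fix C assume C: "C \<in> Chains (relation_of P A)"
    then have sub: "C \<subseteq> A" by (auto simp: Chains_def relation_of_def)
    show "\<exists>u\<in>A. \<forall>a\<in>C. P a u"
    proof (cases "C = {}")
      case True then show ?thesis using p by (auto simp: A_def)
    next
      case False
      obtain u where u: "sublinear u" "\<And>q x. q \<in> C \<Longrightarrow> u x \<le> q x"
      proof (rule sublinear_chain_Inf[OF False, of p])
        show "q \<le> r \<or> r \<le> q" if "q \<in> C" "r \<in> C" for q r
          using C that by (auto simp: Chains_def relation_of_def P_def)
      qed (use sub in \<open>auto simp: A_def le_fun_def\<close>)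
      obtain q where q: "q \<in> C" using False by blast
      then have "q \<in> A" using sub by blast
      then have "u \<in> A"
        using u(1) u(2)[OF q] order_trans by (fastforce simp: A_def le_fun_def)
      with u show ?thesis by (auto simp: P_def le_fun_def)
    qed
  qed
  then obtain m where m: "sublinear m" "m \<le> p"
    and min: "\<And>a. sublinear a \<Longrightarrow> a \<le> p \<Longrightarrow> a \<le> m \<Longrightarrow> a = m"
    by (auto simp: A_def P_def)
  have "linear m"
  proof (rule sublinear_minimal_linear[OF m(1)])
    fix q assume "sublinear q" "\<And>x. q x \<le> m x"
    then have "q \<le> m" by (simp add: le_fun_def)
    with m(2) have "q \<le> p" by (rule order_trans[rotated])
    then show "q = m" using \<open>sublinear q\<close> \<open>q \<le> m\<close> min by blast
  qed
  with m(2) show ?thesis using that by (simp add: le_fun_def)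
qed

text \<open>No functional is extended from the line through \<open>a\<close>. The norm is first
  lowered in the direction \<open>a\<close>, and any linear functional below the result has L (- a)
  <= - norm a, which forces the value at \<open>a\<close>.\<close>

lemma norming_functional:
  fixes a :: "'b::real_normed_vector"
  obtains L :: "'b \<Rightarrow> real" where "bounded_linear L" "\<And>x. \<bar>L x\<bar> \<le> norm x" "L a = norm a"
proof -
  have norm: "sublinear (norm :: 'b \<Rightarrow> real)"
    by (simp add: sublinear_def norm_triangle_ineq)
  obtain q where q: "sublinear q" "\<And>x. q x \<le> norm x" "q (- a) \<le> - norm a"
    using sublinear_directional[OF norm] by metis
  obtain L where L: "linear L" "\<And>x. L x \<le> q x"
    using Hahn_Banach_sublinear[OF q(1)] by metis
  have le: "L x \<le> norm x" for x using L(2)[of x] q(2)[of x] by simp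
  have abs: "\<bar>L x\<bar> \<le> norm x" for x
    using le[of x] le[of "- x"] linear_neg[OF L(1), of x] by (simp add: abs_le_iff)
  have "bounded_linear L"
    using L(1) abs by (intro bounded_linear_intro[where K = 1]) (auto simp: linear_add linear_scale)
  moreover have "L a = norm a"
    using le[of a] L(2)[of "- a"] q(3) linear_neg[OF L(1), of a] by simp
  ultimately show ?thesis using abs that by blast
qed

text \<open>This makes a closed ball a countable intersection of slabs. Functionals norming the
  points of a countable dense set suffice, since each is 1-Lipschitz and nearly norms all vectors
  close to its point.\<close>

lemma countable_norming_family:
  obtains L :: "nat \<Rightarrow> 'b::{real_normed_vector, second_countable_topology} \<Rightarrow> real"
  where "\<And>n. bounded_linear (L n)" "\<And>x t. norm x \<le> t \<longleftrightarrow> (\<forall>n. \<bar>L n x\<bar> \<le> t)"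
proof -
  obtain D :: "'b set" where D: "countable D" "\<And>U. open U \<Longrightarrow> U \<noteq> {} \<Longrightarrow> \<exists>d\<in>D. d \<in> U"
    using countable_dense_setE by blast
  define d where "d = from_nat_into D"
  have "\<forall>n. \<exists>L :: 'b \<Rightarrow> real. bounded_linear L \<and> (\<forall>x. \<bar>L x\<bar> \<le> norm x) \<and> L (d n) = norm (d n)"
    using norming_functional by metis
  then obtain L :: "nat \<Rightarrow> 'b \<Rightarrow> real" where L: "\<And>n. bounded_linear (L n)"
    "\<And>n x. \<bar>L n x\<bar> \<le> norm x" "\<And>n. L n (d n) = norm (d n)"
    by metis
  have "norm x \<le> t" if t: "\<And>n. \<bar>L n x\<bar> \<le> t" for x t
  proof (rule field_le_epsilon)
    fix e :: real assume e: "0 < e"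
    \<comment> \<open>The distance to the dense point is paid twice, once when comparing the norms
      and once inside \<open>L n\<close>; hence e / 2.\<close>
    have "ball x (e / 2) \<noteq> {}" using e by simp
    then obtain y where "y \<in> D" and y: "dist x y < e / 2"
      using D(2)[OF open_ball, of x "e / 2"] by auto
    then obtain n where n: "d n = y"
      using D(1) from_nat_into_surj[of D y] by (auto simp: d_def)
    interpret bounded_linear "L n" by (rule L)
    have "norm x \<le> norm y + norm (x - y)" using norm_triangle_sub .
    also have "norm y = L n x - L n (x - y)" using L(3)[of n] n by (simp add: diff)
    also have "\<dots> \<le> t + norm (x - y)" using t[of n] L(2)[of n "x - y"] by simp
    finally show "norm x \<le> t + e" using y by (simp add: dist_norm)
  qed
  then have "norm x \<le> t \<longleftrightarrow> (\<forall>n. \<bar>L n x\<bar> \<le> t)" for x t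
    using L(2) order_trans by blast
  then show ?thesis using L(1) that by blast
qed

section \<open>Uniqueness from the characteristic functional\<close>

lemma borel_measurable_bounded_linear:
  "bounded_linear L \<Longrightarrow> L \<in> borel_measurable borel"
  by (intro borel_measurable_continuous_onI linear_continuous_on)

lemma integrable_bounded_times_iexp:
  fixes w h :: "'a \<Rightarrow> real"
  assumes "finite_measure \<mu>" "w \<in> borel_measurable \<mu>" "h \<in> borel_measurable \<mu>" "\<And>x. \<bar>w x\<bar> \<le> c"
  shows "integrable \<mu> (\<lambda>x. w x *\<^sub>R iexp (h x))"
proof -
  interpret finite_measure \<mu> by fact
  show ?thesis
    using assms by (intro integrable_const_bound[of _ c]) auto
qed

text \<open>Normalising the measures with density \<open>w\<close> and pushing them forward along
  \<open>L\<close> reduces the claim to uniqueness of characteristic functions on the real line. The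
  normalising constants agree by the case t = 0.\<close>

lemma weighted_Levy_uniqueness:
  fixes w :: "'a \<Rightarrow> real" and L :: "'a \<Rightarrow> real"
  assumes prob: "prob_space \<mu>" "prob_space \<nu>" and sets: "sets \<mu> = sets \<nu>"
    and w: "w \<in> borel_measurable \<mu>" "\<And>x. 0 \<le> w x" "\<And>x. w x \<le> c"
    and L: "L \<in> borel_measurable \<mu>"
    and char: "\<And>t. (LINT x|\<mu>. w x *\<^sub>R iexp (t * L x)) = (LINT x|\<nu>. w x *\<^sub>R iexp (t * L x))"
    and A: "A \<in> sets borel"
  shows "(LINT x|\<mu>. w x * indicator A (L x)) = (LINT x|\<nu>. w x * indicator A (L x))"
proof -
  interpret m: prob_space \<mu> by fact
  interpret n: prob_space \<nu> by fact
  have w' [measurable]: "w \<in> borel_measurable \<nu>" "w \<in> borel_measurable \<mu>"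
    and L' [measurable]: "L \<in> borel_measurable \<nu>" "L \<in> borel_measurable \<mu>"
    using w(1) L by (simp_all add: measurable_cong_sets[OF sets refl])
  note [measurable] = A
  have int: "integrable \<mu> w" "integrable \<nu> w"
    using w by (auto intro!: m.integrable_const_bound[of _ c] n.integrable_const_bound[of _ c])
  define I where "I = (LINT x|\<mu>. w x)"
  have "complex_of_real (LINT x|\<mu>. w x) = complex_of_real (LINT x|\<nu>. w x)"
    using char[of 0] by (simp add: scaleR_conv_of_real)
  then have I: "(LINT x|\<mu>. w x) = I" "(LINT x|\<nu>. w x) = I"
    by (simp_all add: I_def)
  show ?thesis
  proof (cases "I = 0")
    \<comment> \<open>With total mass 0 no normalisation is possible, but then \<open>w\<close>
      vanishes almost everywhere and both integrals are 0.\<close>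
    case True
    then have "AE x in \<mu>. w x = 0" "AE x in \<nu>. w x = 0"
      using integral_nonneg_eq_0_iff_AE[OF int(1)] integral_nonneg_eq_0_iff_AE[OF int(2)] w(2) I
      by auto
    then have "(LINT x|\<mu>. w x * indicator A (L x)) = 0" "(LINT x|\<nu>. w x * indicator A (L x)) = 0"
      by (auto intro!: integral_eq_zero_AE)
    then show ?thesis by simp
  next
    case False
    have "0 \<le> I" unfolding I_def using w(2) by (intro Bochner_Integration.integral_nonneg) auto
    with False have I_pos: "0 < I" by simp
    define law where "law \<kappa> = distr (density \<kappa> (\<lambda>x. ennreal (w x / I))) borel L" for \<kappa> :: "'a measure"
    have law: "real_distribution (law \<kappa>)" "char (law \<kappa>) t = (LINT x|\<kappa>. w x *\<^sub>R iexp (t * L x)) / I"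
      "measure (law \<kappa>) A = (LINT x|\<kappa>. w x * indicator A (L x)) / I"
      if \<kappa>: "w \<in> borel_measurable \<kappa>" "L \<in> borel_measurable \<kappa>" "integrable \<kappa> w" "(LINT x|\<kappa>. w x) = I"
      for \<kappa> t
    proof -
      note [measurable] = \<kappa>(1,2)
      have "prob_space (density \<kappa> (\<lambda>x. ennreal (w x / I)))"
      proof
        have "(\<integral>\<^sup>+x. ennreal (w x / I) \<partial>\<kappa>) = ennreal (LINT x|\<kappa>. w x / I)"
          using \<kappa> w(2) I_pos by (intro nn_integral_eq_integral) auto
        also have "\<dots> = 1" using \<kappa>(4) I_pos by simp
        finally show "emeasure (density \<kappa> (\<lambda>x. ennreal (w x / I)))
            (space (density \<kappa> (\<lambda>x. ennreal (w x / I)))) = 1"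
          by (simp add: emeasure_density cong: nn_integral_cong)
      qed
      then interpret p: prob_space "density \<kappa> (\<lambda>x. ennreal (w x / I))" .
      have p: "prob_space (law \<kappa>)" unfolding law_def by (intro p.prob_space_distr) simp
      then show "real_distribution (law \<kappa>)"
        by (auto simp: real_distribution_def real_distribution_axioms_def law_def)
      show "char (law \<kappa>) t = (LINT x|\<kappa>. w x *\<^sub>R iexp (t * L x)) / I"
      proof -
        have "char (law \<kappa>) t = (LINT x|\<kappa>. (w x / I) *\<^sub>R iexp (t * L x))"
          using w(2) I_pos by (simp add: char_def law_def integral_distr integral_density)
        also have "\<dots> = (LINT x|\<kappa>. (w x *\<^sub>R iexp (t * L x)) / I)"
          by (simp add: scaleR_conv_of_real)
        finally show ?thesis by simp
      qed
      have "measure (law \<kappa>) A = (LINT y|law \<kappa>. indicator A y)"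
        by (simp add: law_def)
      also have "\<dots> = (LINT x|\<kappa>. (w x / I) *\<^sub>R indicator A (L x))"
        using w(2) I_pos unfolding law_def by (subst integral_distr, simp, simp, subst integral_density) auto
      also have "\<dots> = (LINT x|\<kappa>. (w x * indicator A (L x)) / I)" by simp
      finally show "measure (law \<kappa>) A = (LINT x|\<kappa>. w x * indicator A (L x)) / I" by simp
    qed
    have "law \<mu> = law \<nu>"
      using law(1)[OF w'(2) L'(2) int(1) I(1)] law(1)[OF w'(1) L'(1) int(2) I(2)]
    proof (rule Levy_uniqueness)
      show "char (law \<mu>) = char (law \<nu>)"
        using law(2)[OF w'(2) L'(2) int(1) I(1)] law(2)[OF w'(1) L'(1) int(2) I(2)] char by auto
    qed
    then show ?thesis
      using law(3)[OF w'(2) L'(2) int(1) I(1)] law(3)[OF w'(1) L'(1) int(2) I(2)] I_pos by simp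
  qed
qed

text \<open>Tilting \<open>w\<close> by the nonnegative factors \<open>1 + cos K\<close> and \<open>1 + sin K\<close> keeps it a weight,
  so the one-dimensional result applies to each of them.\<close>

lemma char_functional_restrict:
  fixes w :: "'b::{banach, second_countable_topology} \<Rightarrow> real" and L K :: "'b \<Rightarrow> real"
  assumes prob: "prob_space \<mu>" "prob_space \<nu>" and sets: "sets \<mu> = sets borel" "sets \<nu> = sets borel"
    and w: "w \<in> borel_measurable borel" "\<And>x. 0 \<le> w x" "\<And>x. w x \<le> 1"
    and char: "\<And>L :: 'b \<Rightarrow> real. bounded_linear L \<Longrightarrow>
      (LINT x|\<mu>. w x *\<^sub>R iexp (L x)) = (LINT x|\<nu>. w x *\<^sub>R iexp (L x))"
    and L: "bounded_linear L" and K: "bounded_linear K" and A: "A \<in> sets borel"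
  shows "(LINT x|\<mu>. (w x * indicator A (L x)) *\<^sub>R iexp (K x)) =
    (LINT x|\<nu>. (w x * indicator A (L x)) *\<^sub>R iexp (K x))"
proof -
  interpret m: prob_space \<mu> by fact
  interpret n: prob_space \<nu> by fact
  note [measurable_cong] = sets
  note [measurable] = w(1) A
  note [measurable] = borel_measurable_bounded_linear[OF L] borel_measurable_bounded_linear[OF K]
  \<comment> \<open>The hypothesis covers all functionals, hence all combinations t L + s K, and so
    controls \<open>L\<close> and \<open>K\<close> jointly.\<close>
  have comb: "bounded_linear (\<lambda>x. t * L x + s * K x)" for t s
    using L K by (intro bounded_linear_add bounded_linear_const_mult)
  have abs_w: "\<bar>w x\<bar> \<le> 1" for x using w(2,3)[of x] by simp
  have fin: "finite_measure \<mu>" "finite_measure \<nu>" by unfold_locales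
  have int: "integrable \<mu> (\<lambda>x. w x *\<^sub>R iexp (t * L x + s * K x))"
    "integrable \<nu> (\<lambda>x. w x *\<^sub>R iexp (t * L x + s * K x))" for t s
    by (rule integrable_bounded_times_iexp[OF fin(1) _ _ abs_w], simp, simp)
       (rule integrable_bounded_times_iexp[OF fin(2) _ _ abs_w], simp, simp)
  have eq: "(LINT x|\<mu>. w x *\<^sub>R iexp (t * L x + s * K x)) = (LINT x|\<nu>. w x *\<^sub>R iexp (t * L x + s * K x))"
    for t s by (rule char[OF comb])
  \<comment> \<open>Euler's formulas turn each tilted integrand into a combination of exponentials
    of t L, t L + K and t L - K, whose integrals are known to agree.\<close>
  have cos: "(w x * (1 + cos (K x))) *\<^sub>R iexp (t * L x) =
      w x *\<^sub>R iexp (t * L x + 0 * K x) + (w x *\<^sub>R iexp (t * L x + 1 * K x) +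
      w x *\<^sub>R iexp (t * L x + (-1) * K x)) / 2" for t x
    by (simp add: complex_eq_iff cos_add sin_add cos_diff sin_diff Re_exp Im_exp algebra_simps)
  have sin: "(w x * (1 + sin (K x))) *\<^sub>R iexp (t * L x) =
      w x *\<^sub>R iexp (t * L x + 0 * K x) + (w x *\<^sub>R iexp (t * L x + 1 * K x) -
      w x *\<^sub>R iexp (t * L x + (-1) * K x)) / (2 * \<i>)" for t x
    by (simp add: complex_eq_iff cos_add sin_add cos_diff sin_diff Re_exp Im_exp Re_divide Im_divide algebra_simps power2_eq_square)
  define E where "E g \<longleftrightarrow> (LINT x|\<mu>. w x * g x * indicator A (L x)) =
    (LINT x|\<nu>. w x * g x * indicator A (L x))" for g :: "'b \<Rightarrow> real"
  have E: "E g" if g: "g \<in> borel_measurable borel" "\<And>x. 0 \<le> g x" "\<And>x. g x \<le> 2"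
    and "\<And>t. (LINT x|\<mu>. (w x * g x) *\<^sub>R iexp (t * L x)) = (LINT x|\<nu>. (w x * g x) *\<^sub>R iexp (t * L x))"
    for g
    unfolding E_def
  proof (rule weighted_Levy_uniqueness[OF prob, where c = 2])
    show "w x * g x \<le> 2" for x
      using mult_mono[of "w x" 1 "g x" 2] w(2,3)[of x] g(2,3)[of x] by simp
  qed (use that w in \<open>auto simp: sets\<close>)
  have E1: "E (\<lambda>_. 1)"
    by (rule E) (use eq[of _ 0] in auto)
  have "E (\<lambda>x. 1 + cos (K x))"
  proof (rule E)
    show "0 \<le> 1 + cos (K x)" "1 + cos (K x) \<le> 2" for x
      using cos_ge_minus_one[of "K x"] cos_le_one[of "K x"] by linarith+
    show "(LINT x|\<mu>. (w x * (1 + cos (K x))) *\<^sub>R iexp (t * L x)) =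
        (LINT x|\<nu>. (w x * (1 + cos (K x))) *\<^sub>R iexp (t * L x))" for t
      unfolding cos using int eq
      by (simp only: Bochner_Integration.integral_add Bochner_Integration.integrable_add
          integral_divide_zero integrable_divide_zero)
  qed simp
  moreover have "E (\<lambda>x. 1 + sin (K x))"
  proof (rule E)
    show "0 \<le> 1 + sin (K x)" "1 + sin (K x) \<le> 2" for x
      using sin_ge_minus_one[of "K x"] sin_le_one[of "K x"] by linarith+
    show "(LINT x|\<mu>. (w x * (1 + sin (K x))) *\<^sub>R iexp (t * L x)) =
        (LINT x|\<nu>. (w x * (1 + sin (K x))) *\<^sub>R iexp (t * L x))" for t
      unfolding sin using int eq
      by (simp only: Bochner_Integration.integral_add Bochner_Integration.integral_diff
          Bochner_Integration.integrable_add Bochner_Integration.integrable_diff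
          integral_divide_zero integrable_divide_zero)
  qed simp
  ultimately have EE: "E (\<lambda>x. 1 + cos (K x))" "E (\<lambda>x. 1 + sin (K x))" .
  have bnd: "\<bar>w x * indicator A (L x)\<bar> \<le> 1" "\<bar>w x * indicator A (L x) * cos (K x)\<bar> \<le> 1"
    "\<bar>w x * indicator A (L x) * sin (K x)\<bar> \<le> 1" for x
    using abs_w[of x] by (auto simp: indicator_def abs_mult intro!: mult_le_one)
  have int': "integrable \<kappa> (\<lambda>x. w x * indicator A (L x))"
    "integrable \<kappa> (\<lambda>x. w x * indicator A (L x) * cos (K x))"
    "integrable \<kappa> (\<lambda>x. w x * indicator A (L x) * sin (K x))"
    if "finite_measure \<kappa>" and [measurable_cong]: "sets \<kappa> = sets borel" for \<kappa>
    using bnd by (auto intro!: finite_measure.integrable_const_bound[OF that(1), of _ 1])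
  note i = int'[OF fin(1) sets(1)] int'[OF fin(2) sets(2)]
  have split: "(LINT x|\<kappa>. w x * (1 + h x) * indicator A (L x)) =
      (LINT x|\<kappa>. w x * 1 * indicator A (L x)) + (LINT x|\<kappa>. w x * indicator A (L x) * h x)"
    if "integrable \<kappa> (\<lambda>x. w x * indicator A (L x))" "integrable \<kappa> (\<lambda>x. w x * indicator A (L x) * h x)"
    for \<kappa> and h :: "'b \<Rightarrow> real"
    using that by (subst Bochner_Integration.integral_add[symmetric]) (auto simp: algebra_simps)
  \<comment> \<open>Subtracting the untilted identity \<open>E1\<close> leaves the integrals of cos
    K and sin K over the slab, the real and imaginary parts of the claim.\<close>
  have c: "(LINT x|\<mu>. w x * indicator A (L x) * cos (K x)) = (LINT x|\<nu>. w x * indicator A (L x) * cos (K x))"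
    using EE(1) E1 unfolding E_def split[OF i(1,2)] split[OF i(4,5)] by simp
  have s: "(LINT x|\<mu>. w x * indicator A (L x) * sin (K x)) = (LINT x|\<nu>. w x * indicator A (L x) * sin (K x))"
    using EE(2) E1 unfolding E_def split[OF i(1,3)] split[OF i(4,6)] by simp
  have parts: "(LINT x|\<kappa>. (w x * indicator A (L x)) *\<^sub>R iexp (K x)) =
      complex_of_real (LINT x|\<kappa>. w x * indicator A (L x) * cos (K x)) +
      \<i> * complex_of_real (LINT x|\<kappa>. w x * indicator A (L x) * sin (K x))"
    if "integrable \<kappa> (\<lambda>x. w x * indicator A (L x) * cos (K x))"
      "integrable \<kappa> (\<lambda>x. w x * indicator A (L x) * sin (K x))" for \<kappa>
  proof -
    have "(w x * indicator A (L x)) *\<^sub>R iexp (K x) =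
        complex_of_real (w x * indicator A (L x) * cos (K x)) +
        \<i> * complex_of_real (w x * indicator A (L x) * sin (K x))" for x
      by (simp add: complex_eq_iff Re_exp Im_exp)
    then show ?thesis using that by (simp del: of_real_mult)
  qed
  show ?thesis unfolding parts[OF i(2,3)] parts[OF i(5,6)] c s ..
qed

text \<open>The closed ball is the decreasing limit of the sets \<open>C n\<close> cut out by
  finitely many slabs of a norming family. The measures agree on each \<open>C n\<close>, and
  continuity from above gives the ball.\<close>

lemma char_functional_norm_unique:
  fixes \<mu> \<nu> :: "'b::{banach, second_countable_topology} measure"
  assumes prob: "prob_space \<mu>" "prob_space \<nu>" and sets: "sets \<mu> = sets borel" "sets \<nu> = sets borel"
    and char: "\<And>L :: 'b \<Rightarrow> real. bounded_linear L \<Longrightarrow>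
      (LINT x|\<mu>. iexp (L x)) = (LINT x|\<nu>. iexp (L x))"
  shows "measure \<mu> {x. norm x \<le> t} = measure \<nu> {x. norm x \<le> t}"
proof -
  interpret m: prob_space \<mu> by fact
  interpret n: prob_space \<nu> by fact
  obtain L :: "nat \<Rightarrow> 'b \<Rightarrow> real" where L: "\<And>n. bounded_linear (L n)"
    "\<And>x t. norm x \<le> t \<longleftrightarrow> (\<forall>n. \<bar>L n x\<bar> \<le> t)"
    by (rule countable_norming_family) blast
  note [measurable] = borel_measurable_bounded_linear[OF L(1)]
  define C where "C n = {x. \<forall>k<n. \<bar>L k x\<bar> \<le> t}" for n
  have C [measurable]: "C n \<in> sets borel" for n
    unfolding C_def by measurable
  have C_Suc: "indicator (C (Suc n)) x = indicator (C n) x * (indicator {-t..t} (L n x) :: real)" for n x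
    by (auto simp: C_def indicator_def less_Suc_eq)
  \<comment> \<open>Carrying the factor exp (i K) for every \<open>K\<close> lets the induction cut
    off one more slab each time. The case K = 0 gives back the measure of
    \<open>C n\<close>.\<close>
  have eq: "(LINT x|\<mu>. (indicator (C n) x :: real) *\<^sub>R iexp (K x)) =
      (LINT x|\<nu>. (indicator (C n) x :: real) *\<^sub>R iexp (K x))"
    if "bounded_linear K" for n and K :: "'b \<Rightarrow> real"
    using that
  proof (induction n arbitrary: K)
    case 0
    then show ?case using char by (simp add: C_def)
  next
    case (Suc n)
    show ?case unfolding C_Suc
      by (rule char_functional_restrict[OF prob sets _ _ _ Suc.IH L(1) Suc.prems])
         (auto simp: indicator_def)
  qed
  have eq_C: "measure \<mu> (C n) = measure \<nu> (C n)" for n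
  proof -
    have "complex_of_real (measure \<mu> (C n)) = complex_of_real (measure \<nu> (C n))"
      using eq[OF bounded_linear_zero, of n]
      by (simp add: scaleR_conv_of_real sets_eq_imp_space_eq[OF sets(1)] sets_eq_imp_space_eq[OF sets(2)])
    then show ?thesis by simp
  qed
  have Inter: "(\<Inter>n. C n) = {x. norm x \<le> t}"
    unfolding L(2) by (auto simp: C_def)
  have dec: "decseq C" by (auto simp: decseq_def C_def)
  have "(\<lambda>n. measure \<mu> (C n)) \<longlonglongrightarrow> measure \<mu> (\<Inter>n. C n)"
    using C by (intro m.finite_Lim_measure_decseq dec) (simp add: sets image_subset_iff)
  moreover have "(\<lambda>n. measure \<nu> (C n)) \<longlonglongrightarrow> measure \<nu> (\<Inter>n. C n)"
    using C by (intro n.finite_Lim_measure_decseq dec) (simp add: sets image_subset_iff)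
  ultimately show ?thesis
    unfolding eq_C Inter by (rule LIMSEQ_unique)
qed

section \<open>Random Gaussian series\<close>

lemma char_distr_mult:
  fixes Y :: "'a \<Rightarrow> real"
  assumes [measurable]: "Y \<in> borel_measurable M"
  shows "char (distr M borel (\<lambda>\<omega>. c * Y \<omega>)) t = char (distr M borel Y) (t * c)"
  by (simp add: char_def integral_distr mult.assoc)

context prob_space
begin

text \<open>One exponent \<open>s\<close> covers both cases, 0 for a degenerate variable and half
  the variance otherwise. Zero expectation makes the constant, respectively the mean,
  vanish.\<close>

lemma char_centered_gaussian:
  assumes "real_gaussian M Y" "expectation Y = 0"
  obtains s where "\<And>t. char (distr M borel Y) t = complex_of_real (exp (- s * t\<^sup>2))"
proof -
  have Y [measurable]: "Y \<in> borel_measurable M"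
    using assms(1) by (simp add: real_gaussian_def)
  consider (const) c where "AE \<omega> in M. Y \<omega> = c"
    | (normal) c \<sigma> where "0 < \<sigma>" "distributed M lborel Y (normal_density c \<sigma>)"
    using assms(1) by (auto simp: real_gaussian_def)
  then show ?thesis
  proof cases
    case const
    then have "expectation Y = expectation (\<lambda>_. c)" by (intro integral_cong_AE) auto
    then have "c = 0" using assms(2) by (simp add: prob_space)
    then have "expectation (\<lambda>\<omega>. iexp (t * Y \<omega>)) = expectation (\<lambda>_. 1)" for t
      using const by (intro integral_cong_AE) auto
    then have "char (distr M borel Y) t = 1" for t
      by (simp add: char_def integral_distr prob_space)
    then show ?thesis using that[of 0] by simp
  next
    case normal
    have "c = 0" using normal_distributed_expectation[OF normal] assms(2) by simp
    then have std: "distributed M lborel (\<lambda>\<omega>. Y \<omega> / \<sigma>) std_normal_density"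
      using normal_standard_normal_convert[OF normal(1), of Y c] normal(2) by simp
    have distr: "distr M borel (\<lambda>\<omega>. Y \<omega> / \<sigma>) = std_normal_distribution"
      using distributed_distr_eq_density[OF std] by (simp cong: distr_cong)
    have "char (distr M borel Y) t = exp (- (\<sigma>\<^sup>2 / 2) * t\<^sup>2)" for t
    proof -
      have "char (distr M borel (\<lambda>\<omega>. \<sigma> * (Y \<omega> / \<sigma>))) t = char std_normal_distribution (t * \<sigma>)"
        unfolding distr[symmetric] by (rule char_distr_mult) simp
      then show ?thesis
        using normal(1) by (simp add: char_std_normal_distribution power_mult_distrib field_simps)
    qed
    then show ?thesis using that by blast
  qed
qed

text \<open>Under a functional, all summands share one exponent s, because the laws are identical.
  Independence multiplies the factors exp (- s c_k^2), and the product is the factor of a single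
  copy scaled by the root of the sum of squares. Equal characteristic functionals give equal laws of
  the norm.\<close>

lemma gaussian_sum_norm:
  fixes Z :: "'i \<Rightarrow> 'a \<Rightarrow> 'b::{banach, second_countable_topology}"
  assumes gauss: "\<And>k. k \<in> insert i I \<Longrightarrow> gaussian_rv M (Z k)"
    and centered: "\<And>k (L :: 'b \<Rightarrow> real). bounded_linear L \<Longrightarrow> expectation (\<lambda>\<omega>. L (Z k \<omega>)) = 0"
    and indep: "indep_vars (\<lambda>_. borel) Z I"
    and ident: "\<And>k. k \<in> I \<Longrightarrow> distr M borel (Z k) = distr M borel (Z i)"
  shows "prob {\<omega> \<in> space M. norm (\<Sum>k\<in>I. c k *\<^sub>R Z k \<omega>) \<le> t} =
    prob {\<omega> \<in> space M. sqrt (\<Sum>k\<in>I. (c k)\<^sup>2) * norm (Z i \<omega>) \<le> t}"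
proof -
  have Z [measurable]: "Z k \<in> borel_measurable M" if "k \<in> insert i I" for k
    using gauss[OF that] by (simp add: gaussian_rv_def)
  define r where "r = sqrt (\<Sum>k\<in>I. (c k)\<^sup>2)"
  have r: "0 \<le> r" "r\<^sup>2 = (\<Sum>k\<in>I. (c k)\<^sup>2)" by (simp_all add: r_def sum_nonneg)
  define U where "U \<omega> = (\<Sum>k\<in>I. c k *\<^sub>R Z k \<omega>)" for \<omega>
  define V where "V \<omega> = r *\<^sub>R Z i \<omega>" for \<omega>
  have UV [measurable]: "U \<in> borel_measurable M" "V \<in> borel_measurable M"
    unfolding U_def V_def by measurable
  have "measure (distr M borel U) {x. norm x \<le> t} = measure (distr M borel V) {x. norm x \<le> t}"
  proof (rule char_functional_norm_unique)
    fix L :: "'b \<Rightarrow> real" assume L: "bounded_linear L"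
    note [measurable] = borel_measurable_bounded_linear[OF L]
    have "real_gaussian M (\<lambda>\<omega>. L (Z i \<omega>))"
      using gauss[of i] L by (simp add: gaussian_rv_def)
    then obtain s where s: "\<And>t. char (distr M borel (\<lambda>\<omega>. L (Z i \<omega>))) t = complex_of_real (exp (- s * t\<^sup>2))"
      using char_centered_gaussian centered[OF L, of i] by blast
    have distr_L: "distr M borel (\<lambda>\<omega>. L (Z k \<omega>)) = distr (distr M borel (Z k)) borel L"
      if "k \<in> insert i I" for k
      using that by (subst distr_distr) (auto simp: comp_def)
    have char_k: "char (distr M borel (\<lambda>\<omega>. c k * L (Z k \<omega>))) 1 = complex_of_real (exp (- s * (c k)\<^sup>2))"
      if "k \<in> I" for k
    proof -
      have "distr M borel (\<lambda>\<omega>. L (Z k \<omega>)) = distr M borel (\<lambda>\<omega>. L (Z i \<omega>))"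
        using that by (simp add: distr_L ident)
      then show ?thesis using that by (subst char_distr_mult) (simp_all add: s)
    qed
    have "(LINT x|distr M borel U. iexp (L x)) =
        char (distr M borel (\<lambda>\<omega>. \<Sum>k\<in>I. c k * L (Z k \<omega>))) 1"
      using L by (simp add: char_def integral_distr U_def linear_sum bounded_linear.linear linear_scale)
    also have "\<dots> = (\<Prod>k\<in>I. char (distr M borel (\<lambda>\<omega>. c k * L (Z k \<omega>))) 1)"
      by (intro char_distr_sum indep_vars_compose2[OF indep]) simp
    also have "\<dots> = (\<Prod>k\<in>I. complex_of_real (exp (- s * (c k)\<^sup>2)))"
      using char_k by simp
    also have "\<dots> = complex_of_real (exp (- s * r\<^sup>2))"
    \<comment> \<open>For infinite \<open>I\<close> the default values 0 of the sum and 1 of the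
      product make both sides 1.\<close>
    proof (cases "finite I")
      case True
      then show ?thesis by (simp add: r(2) exp_sum sum_distrib_left flip: of_real_prod sum_negf)
    qed (simp add: r(2))
    also have "\<dots> = char (distr M borel (\<lambda>\<omega>. r * L (Z i \<omega>))) 1"
      by (subst char_distr_mult) (auto simp: s)
    also have "\<dots> = (LINT x|distr M borel V. iexp (L x))"
      using L by (simp add: char_def integral_distr V_def bounded_linear.linear linear_scale)
    finally show "(LINT x|distr M borel U. iexp (L x)) = (LINT x|distr M borel V. iexp (L x))" .
  qed (auto intro!: prob_space_distr)
  then have "prob (U -` {x. norm x \<le> t} \<inter> space M) = prob (V -` {x. norm x \<le> t} \<inter> space M)"
    by (simp add: measure_distr)
  moreover have "U -` {x. norm x \<le> t} \<inter> space M = {\<omega> \<in> space M. norm (\<Sum>k\<in>I. c k *\<^sub>R Z k \<omega>) \<le> t}"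
    by (auto simp: U_def)
  moreover have "V -` {x. norm x \<le> t} \<inter> space M = {\<omega> \<in> space M. r * norm (Z i \<omega>) \<le> t}"
    using r(1) by (auto simp: V_def)
  ultimately show ?thesis by (simp add: r_def)
qed

section \<open>Almost sure convergence of sums of independent variables\<close>

text \<open>The event is split by the first index j at which the partial sum exceeds 2t. If the
  remaining block from j to n has norm at most t, the full sum still exceeds t. That block is
  independent of the past and is small with probability at least 1/2, which costs the factor
  2.\<close>

lemma ottaviani_inequality:
  fixes Y :: "nat \<Rightarrow> 'a \<Rightarrow> 'b::{real_normed_vector, second_countable_topology}"
  assumes indep: "indep_vars (\<lambda>_. borel) Y UNIV"
    and half: "\<And>j. m \<le> j \<Longrightarrow> j \<le> n \<Longrightarrow> prob {\<omega> \<in> space M. t < norm (\<Sum>k\<in>{j..<n}. Y k \<omega>)} \<le> 1 / 2"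
  shows "prob {\<omega> \<in> space M. \<exists>j\<in>{m..n}. 2 * t < norm (\<Sum>k\<in>{m..<j}. Y k \<omega>)} \<le>
    2 * prob {\<omega> \<in> space M. t < norm (\<Sum>k\<in>{m..<n}. Y k \<omega>)}"
proof -
  have Y [measurable]: "Y k \<in> borel_measurable M" for k
    using indep by (simp add: indep_vars_def)
  define P where "P i j \<omega> = (\<Sum>k\<in>{i..<j}. Y k \<omega>)" for i j \<omega>
  have [measurable]: "P i j \<in> borel_measurable M" for i j
    unfolding P_def by measurable
  define first where "first j = {\<omega> \<in> space M. 2 * t < norm (P m j \<omega>) \<and>
    (\<forall>i\<in>{m..<j}. norm (P m i \<omega>) \<le> 2 * t)}" for j
  define small where "small j = {\<omega> \<in> space M. norm (P j n \<omega>) \<le> t}" for j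
  have [measurable]: "first j \<in> events" "small j \<in> events" for j
    unfolding first_def small_def by measurable
  have indep_j: "prob (first j \<inter> small j) = prob (first j) * prob (small j)" if "m \<le> j" for j
  proof -
    \<comment> \<open>\<open>first j\<close> depends only on the variables before j and
      \<open>small j\<close> only on those from j on. Writing them as preimages under the two
      restricted families makes the independence of the families applicable.\<close>
    let ?A = "\<lambda>\<omega>. restrict (\<lambda>i. Y i \<omega>) {..<j}" and ?B = "\<lambda>\<omega>. restrict (\<lambda>i. Y i \<omega>) {j..}"
    let ?PA = "PiM {..<j} (\<lambda>_. borel :: 'b measure)" and ?PB = "PiM {j..} (\<lambda>_. borel :: 'b measure)"
    have ind: "indep_var ?PA ?A ?PB ?B"
      using indep by (rule indep_var_restrict) auto
    define XA where "XA = {f \<in> space ?PA. 2 * t < norm (\<Sum>k\<in>{m..<j}. f k) \<and>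
      (\<forall>i\<in>{m..<j}. norm (\<Sum>k\<in>{m..<i}. f k) \<le> 2 * t)}"
    define XB where "XB = {f \<in> space ?PB. norm (\<Sum>k\<in>{j..<n}. f k) \<le> t}"
    have sumA: "(\<lambda>f. \<Sum>k\<in>{m..<i}. f k) \<in> borel_measurable ?PA" if "i \<le> j" for i
      using that by (intro borel_measurable_sum measurable_component_singleton) auto
    have [measurable]: "(\<lambda>f. \<Sum>k\<in>{m..<j}. f k) \<in> borel_measurable ?PA" by (rule sumA) simp
    have "{f \<in> space ?PA. \<forall>i\<in>{m..<j}. norm (\<Sum>k\<in>{m..<i}. f k) \<le> 2 * t} \<in> sets ?PA"
    proof (rule sets.sets_Collect_finite_All)
      fix i assume "i \<in> {m..<j}"
      then have [measurable]: "(\<lambda>f. \<Sum>k\<in>{m..<i}. f k) \<in> borel_measurable ?PA" by (intro sumA) simp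
      show "{f \<in> space ?PA. norm (\<Sum>k\<in>{m..<i}. f k) \<le> 2 * t} \<in> sets ?PA" by measurable
    qed simp
    moreover have "{f \<in> space ?PA. 2 * t < norm (\<Sum>k\<in>{m..<j}. f k)} \<in> sets ?PA" by measurable
    moreover have "XA = {f \<in> space ?PA. \<forall>i\<in>{m..<j}. norm (\<Sum>k\<in>{m..<i}. f k) \<le> 2 * t} \<inter>
        {f \<in> space ?PA. 2 * t < norm (\<Sum>k\<in>{m..<j}. f k)}"
      by (auto simp: XA_def)
    ultimately have XA: "XA \<in> sets ?PA" by simp
    have [measurable]: "(\<lambda>f. \<Sum>k\<in>{j..<n}. f k) \<in> borel_measurable ?PB"
      by (intro borel_measurable_sum measurable_component_singleton) auto
    have XB: "XB \<in> sets ?PB" unfolding XB_def by measurable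
    have first: "?A -` XA \<inter> space M = first j"
    proof -
      have "(\<Sum>k\<in>{m..<i}. ?A \<omega> k) = P m i \<omega>" if "i \<le> j" for i \<omega>
        using that by (auto simp: P_def intro!: sum.cong)
      then show ?thesis by (auto simp: XA_def first_def space_PiM)
    qed
    have small: "?B -` XB \<inter> space M = small j"
    proof -
      have "(\<Sum>k\<in>{j..<n}. ?B \<omega> k) = P j n \<omega>" for \<omega>
        by (auto simp: P_def intro!: sum.cong)
      then show ?thesis by (auto simp: XB_def small_def space_PiM)
    qed
    have "(\<lambda>x. (?A x, ?B x)) -` (XA \<times> XB) \<inter> space M = first j \<inter> small j"
      using first small by blast
    then show ?thesis using indep_varD[OF ind XA XB] first small by simp
  qed
  have half': "prob (first j) \<le> 2 * prob (first j \<inter> small j)" if "j \<in> {m..n}" for j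
  proof -
    have "{\<omega> \<in> space M. t < norm (\<Sum>k\<in>{j..<n}. Y k \<omega>)} = space M - small j"
      by (auto simp: small_def P_def)
    then have "1 / 2 \<le> prob (small j)"
      using half[of j] that by (simp add: prob_compl)
    then have "prob (first j) * 1 \<le> prob (first j) * (2 * prob (small j))"
      by (intro mult_left_mono) auto
    then show ?thesis using indep_j[of j] that by simp
  qed
  have disj: "disjoint_family_on first {m..n}"
  proof -
    have "first i \<inter> first j = {}" if "i < j" "m \<le> i" for i j
      using that by (force simp: first_def)
    then show ?thesis
      unfolding disjoint_family_on_def by (metis Int_commute atLeastAtMost_iff linorder_neqE_nat)
  qed
  have "{\<omega> \<in> space M. \<exists>j\<in>{m..n}. 2 * t < norm (P m j \<omega>)} \<subseteq> (\<Union>j\<in>{m..n}. first j)"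
  proof safe
    fix \<omega> j assume \<omega>: "\<omega> \<in> space M" and j: "j \<in> {m..n}" "2 * t < norm (P m j \<omega>)"
    define l where "l = (LEAST l. m \<le> l \<and> 2 * t < norm (P m l \<omega>))"
    have "m \<le> l \<and> 2 * t < norm (P m l \<omega>)" unfolding l_def by (rule LeastI[of _ j]) (use j in auto)
    moreover have "l \<le> j" unfolding l_def by (rule Least_le) (use j in auto)
    moreover have "norm (P m i \<omega>) \<le> 2 * t" if "i \<in> {m..<l}" for i
      using not_less_Least[of i "\<lambda>l. m \<le> l \<and> 2 * t < norm (P m l \<omega>)"] that by (auto simp: l_def)
    ultimately have "l \<in> {m..n}" "\<omega> \<in> first l" using \<omega> j by (auto simp: first_def)
    then show "\<omega> \<in> (\<Union>j\<in>{m..n}. first j)" by blast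
  qed
  then have "prob {\<omega> \<in> space M. \<exists>j\<in>{m..n}. 2 * t < norm (P m j \<omega>)} \<le> prob (\<Union>j\<in>{m..n}. first j)"
    by (intro finite_measure_mono) auto
  also have "\<dots> = (\<Sum>j\<in>{m..n}. prob (first j))"
    using disj by (intro finite_measure_finite_Union) auto
  also have "\<dots> \<le> (\<Sum>j\<in>{m..n}. 2 * prob (first j \<inter> small j))"
    by (intro sum_mono half')
  also have "\<dots> = 2 * prob (\<Union>j\<in>{m..n}. first j \<inter> small j)"
    using disj by (subst finite_measure_finite_Union)
      (auto simp: sum_distrib_left disjoint_family_on_def)
  also have "prob (\<Union>j\<in>{m..n}. first j \<inter> small j) \<le> prob {\<omega> \<in> space M. t < norm (P m n \<omega>)}"
  proof (intro finite_measure_mono subsetI)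
    fix \<omega> assume "\<omega> \<in> (\<Union>j\<in>{m..n}. first j \<inter> small j)"
    then obtain j where j: "j \<in> {m..n}" "\<omega> \<in> first j" "\<omega> \<in> small j" by blast
    then have "P m n \<omega> = P m j \<omega> + P j n \<omega>"
      by (simp add: P_def sum.atLeastLessThan_concat)
    then have "norm (P m j \<omega>) \<le> norm (P m n \<omega>) + norm (P j n \<omega>)"
      using norm_triangle_ineq4[of "P m n \<omega>" "P j n \<omega>"] by simp
    then show "\<omega> \<in> {\<omega> \<in> space M. t < norm (P m n \<omega>)}"
      using j by (auto simp: first_def small_def)
  qed simp
  finally show ?thesis by (simp add: P_def)
qed

text \<open>Ottaviani's inequality bounds the oscillation after m up to n uniformly in n, so the
  bound survives the limit and turns Cauchy in probability into Cauchy almost surely.\<close>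

lemma indep_sum_AE_convergent:
  fixes Y :: "nat \<Rightarrow> 'a \<Rightarrow> 'b::{banach, second_countable_topology}"
  assumes indep: "indep_vars (\<lambda>_. borel) Y UNIV"
    and cauchy: "\<And>t e. 0 < t \<Longrightarrow> 0 < e \<Longrightarrow>
      \<exists>m. \<forall>i\<ge>m. \<forall>j. prob {\<omega> \<in> space M. t < norm (\<Sum>k\<in>{i..<j}. Y k \<omega>)} \<le> e"
  shows "AE \<omega> in M. convergent (\<lambda>n. \<Sum>k<n. Y k \<omega>)"
proof -
  have Y [measurable]: "Y k \<in> borel_measurable M" for k
    using indep by (simp add: indep_vars_def)
  define P where "P i j \<omega> = (\<Sum>k\<in>{i..<j}. Y k \<omega>)" for i j \<omega>
  have [measurable]: "P i j \<in> borel_measurable M" for i j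
    unfolding P_def by measurable
  have ae: "AE \<omega> in M. \<exists>m. \<forall>j\<ge>m. norm (P m j \<omega>) \<le> 2 * t" if t: "0 < t" for t
  proof -
    define bad where "bad = {\<omega> \<in> space M. \<forall>m. \<exists>j. m \<le> j \<and> 2 * t < norm (P m j \<omega>)}"
    have [measurable]: "bad \<in> events" unfolding bad_def by measurable
    have "prob bad \<le> e" if e: "0 < e" for e
    proof -
      \<comment> \<open>The bound 1 / 2 is the hypothesis of Ottaviani's inequality, and e / 2
        absorbs its factor 2.\<close>
      obtain m where m: "\<And>i j. m \<le> i \<Longrightarrow> prob {\<omega> \<in> space M. t < norm (P i j \<omega>)} \<le> min (1 / 2) (e / 2)"
        using cauchy[OF t, of "min (1 / 2) (e / 2)"] e by (auto simp: P_def)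
      define E where "E n = {\<omega> \<in> space M. \<exists>j\<in>{m..n}. 2 * t < norm (P m j \<omega>)}" for n
      have [measurable]: "E n \<in> events" for n unfolding E_def by measurable
      have E_le: "prob (E n) \<le> e" for n
      proof -
        have "prob (E n) \<le> 2 * prob {\<omega> \<in> space M. t < norm (P m n \<omega>)}"
          using m unfolding E_def P_def by (intro ottaviani_inequality[OF indep]) simp
        with m[of m n] show ?thesis by simp
      qed
      have "bad \<subseteq> (\<Union>n. E n)" by (force simp: bad_def E_def)
      then have "prob bad \<le> prob (\<Union>n. E n)" by (intro finite_measure_mono) auto
      also have "\<dots> \<le> e"
      proof (rule LIMSEQ_le_const2)
        show "(\<lambda>n. prob (E n)) \<longlonglongrightarrow> prob (\<Union>n. E n)"
          by (intro finite_Lim_measure_incseq) (auto simp: incseq_def E_def)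
      qed (use E_le in blast)
      finally show ?thesis .
    qed
    then have "prob bad = 0"
      by (metis field_le_epsilon measure_le_0_iff add_0)
    then have "AE \<omega> in M. \<omega> \<notin> bad"
      by (subst AE_iff_measurable[of bad]) (auto simp: emeasure_eq_measure bad_def)
    then show ?thesis
      using AE_space
    proof eventually_elim
      case (elim \<omega>) then show ?case by (force simp: bad_def not_less)
    qed
  qed
  \<comment> \<open>Thresholds from a countable null sequence keep the union of the exceptional sets
    null.\<close>
  have "AE \<omega> in M. \<forall>n. \<exists>m. \<forall>j\<ge>m. norm (P m j \<omega>) \<le> 2 * inverse (real (Suc n))"
    unfolding AE_all_countable by (intro allI ae) simp
  then show ?thesis
  proof eventually_elim
    case (elim \<omega>)
    have "Cauchy (\<lambda>n. \<Sum>k<n. Y k \<omega>)"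
    proof (rule metric_CauchyI)
      fix e :: real assume "0 < e"
      then obtain n where n: "inverse (real (Suc n)) < e / 4"
        using reals_Archimedean[of "e / 4"] by auto
      obtain m where m: "\<And>j. m \<le> j \<Longrightarrow> norm (P m j \<omega>) \<le> 2 * inverse (real (Suc n))"
        using elim by blast
      have "dist (\<Sum>k<m. Y k \<omega>) (\<Sum>k<j. Y k \<omega>) < e / 2" if "m \<le> j" for j
      proof -
        have "(\<Sum>k<j. Y k \<omega>) = (\<Sum>k<m. Y k \<omega>) + P m j \<omega>"
          using sum.atLeastLessThan_concat[of 0 m j "\<lambda>k. Y k \<omega>"] that
          by (simp add: P_def atLeast0LessThan)
        then show ?thesis using m[OF that] n by (simp add: dist_norm)
      qed
      then show "\<exists>N. \<forall>i\<ge>N. \<forall>j\<ge>N. dist (\<Sum>k<i. Y k \<omega>) (\<Sum>k<j. Y k \<omega>) < e"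
        using dist_triangle_half_r by blast
    qed
    then show ?case by (rule Cauchy_convergent)
  qed
qed

text \<open>A block sum has norm distributed as \<tau> * norm (Z 0), with \<tau> small uniformly
  over late blocks. The tail probability of norm (Z 0) tends to 0 because the norm is finite
  everywhere, so the series is Cauchy in probability without any moment bound.\<close>

lemma gaussian_series_AE_convergent:
  fixes Z :: "nat \<Rightarrow> 'a \<Rightarrow> 'b::{banach, second_countable_topology}"
  assumes gauss: "\<And>n. gaussian_rv M (Z n)"
    and centered: "\<And>n (L :: 'b \<Rightarrow> real). bounded_linear L \<Longrightarrow> expectation (\<lambda>\<omega>. L (Z n \<omega>)) = 0"
    and indep: "indep_vars (\<lambda>_. borel) Z UNIV"
    and ident: "\<And>m n. distr M borel (Z m) = distr M borel (Z n)"
    and c: "summable (\<lambda>n. (c n)\<^sup>2)"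
  shows "AE \<omega> in M. convergent (\<lambda>n. \<Sum>k<n. c k *\<^sub>R Z k \<omega>)"
proof (rule indep_sum_AE_convergent)
  have Z [measurable]: "Z k \<in> borel_measurable M" for k
    using gauss by (simp add: gaussian_rv_def)
  show "indep_vars (\<lambda>_. borel) (\<lambda>k \<omega>. c k *\<^sub>R Z k \<omega>) UNIV"
    by (rule indep_vars_compose2[OF indep]) simp
  fix t e :: real assume t: "0 < t" and e: "0 < e"
  define big where "big n = {\<omega> \<in> space M. real n < norm (Z 0 \<omega>)}" for n
  have [measurable]: "big n \<in> events" for n unfolding big_def by measurable
  have "(\<lambda>n. prob (big n)) \<longlonglongrightarrow> prob (\<Inter>n. big n)"
    by (intro finite_Lim_measure_decseq) (auto simp: decseq_def big_def)
  moreover have "(\<Inter>n. big n) = {}"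
  proof -
    have "\<exists>n. \<omega> \<notin> big n" for \<omega>
      using reals_Archimedean2[of "norm (Z 0 \<omega>)"] by (auto simp: big_def not_less intro: less_imp_le)
    then show ?thesis by blast
  qed
  ultimately have "eventually (\<lambda>n. prob (big n) < e) sequentially"
    using e by (intro order_tendstoD(2)[of _ 0]) auto
  \<comment> \<open>A positive \<open>n\<close> keeps \<open>t / real n\<close> positive, as the
    Cauchy criterion for the squares requires.\<close>
  then have "eventually (\<lambda>n. prob (big n) < e \<and> 0 < n) sequentially"
    using eventually_gt_at_top[of 0] by eventually_elim simp
  then obtain n where n: "prob (big n) < e" "0 < n"
    by (auto simp: eventually_sequentially)
  obtain m where m: "\<And>i j. m \<le> i \<Longrightarrow> norm (\<Sum>k\<in>{i..<j}. (c k)\<^sup>2) < (t / real n)\<^sup>2"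
    using c[unfolded summable_Cauchy, rule_format, of "(t / real n)\<^sup>2"] t n(2) by auto
  have "prob {\<omega> \<in> space M. t < norm (\<Sum>k\<in>{i..<j}. c k *\<^sub>R Z k \<omega>)} \<le> e" if "m \<le> i" for i j
  proof -
    define \<tau> where "\<tau> = sqrt (\<Sum>k\<in>{i..<j}. (c k)\<^sup>2)"
    have "\<tau> < t / real n"
      unfolding \<tau>_def using m[OF that, of j] t n(2) by (intro real_less_lsqrt) auto
    have eq: "prob {\<omega> \<in> space M. norm (\<Sum>k\<in>{i..<j}. c k *\<^sub>R Z k \<omega>) \<le> t} =
        prob {\<omega> \<in> space M. \<tau> * norm (Z 0 \<omega>) \<le> t}"
      unfolding \<tau>_def using gauss centered ident
      by (intro gaussian_sum_norm indep_vars_subset[OF indep]) auto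
    have compl: "prob {\<omega> \<in> space M. t < f \<omega>} = 1 - prob {\<omega> \<in> space M. f \<omega> \<le> t}"
      if [measurable]: "f \<in> borel_measurable M" for f
    proof -
      have "{\<omega> \<in> space M. t < f \<omega>} = space M - {\<omega> \<in> space M. f \<omega> \<le> t}" by auto
      then show ?thesis by (simp add: prob_compl)
    qed
    have "prob {\<omega> \<in> space M. t < norm (\<Sum>k\<in>{i..<j}. c k *\<^sub>R Z k \<omega>)} =
        prob {\<omega> \<in> space M. t < \<tau> * norm (Z 0 \<omega>)}"
      using eq by (simp add: compl)
    also have "\<dots> \<le> prob (big n)"
    proof (intro finite_measure_mono subsetI)
      fix \<omega> assume "\<omega> \<in> {\<omega> \<in> space M. t < \<tau> * norm (Z 0 \<omega>)}"
      then have \<omega>: "\<omega> \<in> space M" "t < \<tau> * norm (Z 0 \<omega>)" by auto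
      have "\<tau> * norm (Z 0 \<omega>) \<le> t / real n * norm (Z 0 \<omega>)"
        using \<open>\<tau> < t / real n\<close> by (intro mult_right_mono) auto
      with \<omega>(2) have "t < t / real n * norm (Z 0 \<omega>)" by simp
      then have "t * real n < t * norm (Z 0 \<omega>)"
        using n(2) by (simp add: field_simps)
      then show "\<omega> \<in> big n" using \<omega>(1) t by (simp add: big_def)
    qed simp
    finally show ?thesis using n(1) by simp
  qed
  then show "\<exists>m. \<forall>i\<ge>m. \<forall>j. prob {\<omega> \<in> space M. t < norm (\<Sum>k\<in>{i..<j}. c k *\<^sub>R Z k \<omega>)} \<le> e"
    by blast
qed

end

text \<open>\<open>gaussian_rv\<close> admits any mean, so centering is stated separately. A common
  nonzero mean v would add the drift v times the sum of the \<open>\<alpha> k\<close> to the noise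
  series, which diverges.\<close>

theorem theorem1:
  fixes M :: "'w measure"
    and G :: "'b::{banach, second_countable_topology} \<Rightarrow> 'b"
    and xstar x0 :: 'b
    and \<rho> \<theta> :: real
    and \<alpha> :: "nat \<Rightarrow> real"
    and Z X :: "nat \<Rightarrow> 'w \<Rightarrow> 'b"
  assumes "prob_space M"
    and "\<exists>!x. G x = 0"
    and "G xstar = 0"
    and "0 < \<rho>" and "\<rho> < 1" and "1 \<le> \<theta>"
    and "\<And>x. norm (inverse \<theta> *\<^sub>R G x - (x - xstar)) \<le> \<rho> * norm (x - xstar)"
    and "\<And>n. 0 < \<alpha> n" and "\<And>n. \<alpha> n < 1"
    and "\<alpha> \<longlonglongrightarrow> 0"
    and "filterlim (\<lambda>N. \<Sum>n<N. \<alpha> n) at_top sequentially"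
    and "summable (\<lambda>n. (\<alpha> n)\<^sup>2)"
    and "\<And>n. gaussian_rv M (Z n)"
    and centered: "\<And>n (L :: 'b \<Rightarrow> real). bounded_linear L \<Longrightarrow>
           prob_space.expectation M (\<lambda>\<omega>. L (Z n \<omega>)) = 0"
    and "prob_space.indep_vars M (\<lambda>_. borel) Z UNIV"
    and "\<And>m n. distr M borel (Z m) = distr M borel (Z n)"
    and "\<And>\<omega>. \<omega> \<in> space M \<Longrightarrow> X 0 \<omega> = x0"
    and "\<And>n \<omega>. \<omega> \<in> space M \<Longrightarrow>
           X (Suc n) \<omega> = X n \<omega> - \<alpha> n *\<^sub>R (G (X n \<omega>) + Z (Suc n) \<omega>)"
  shows "AE \<omega> in M. (\<lambda>n. X (Suc n) \<omega>) \<longlonglongrightarrow> xstar"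
proof -
  interpret prob_space M by fact
  \<comment> \<open>The recursion pairs \<open>\<alpha> k\<close> with \<open>Z (Suc k)\<close>. The
    padding \<open>c 0 = 0\<close> discards \<open>Z 0\<close>, so the series theorem applies to the
    whole sequence \<open>Z\<close>.\<close>
  define c where "c n = (case n of 0 \<Rightarrow> 0 | Suc k \<Rightarrow> \<alpha> k)" for n
  have "summable (\<lambda>n. (c (Suc n))\<^sup>2)"
    using assms(12) by (simp add: c_def)
  then have c: "summable (\<lambda>n. (c n)\<^sup>2)"
    using summable_Suc_iff[of "\<lambda>n. (c n)\<^sup>2"] by blast
  have "AE \<omega> in M. convergent (\<lambda>n. \<Sum>k<n. c k *\<^sub>R Z k \<omega>)"
    by (rule gaussian_series_AE_convergent[OF assms(13) centered assms(15,16) c])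
  then show ?thesis
    using AE_space
  proof eventually_elim
    case (elim \<omega>)
    have sum: "(\<Sum>k<Suc n. c k *\<^sub>R Z k \<omega>) = (\<Sum>k<n. \<alpha> k *\<^sub>R Z (Suc k) \<omega>)" for n
      unfolding sum.lessThan_Suc_shift by (simp add: c_def)
    have conv: "convergent (\<lambda>n. \<Sum>k<n. \<alpha> k *\<^sub>R Z (Suc k) \<omega>)"
      using elim(1) convergent_Suc_iff[of "\<lambda>n. \<Sum>k<n. c k *\<^sub>R Z k \<omega>"] by (simp only: sum)
    have "(\<lambda>n. X n \<omega>) \<longlonglongrightarrow> xstar"
    proof (rule stochastic_approximation_path)
      show "0 \<le> \<rho>" "0 < \<theta>" using assms(4,6) by simp_all
    qed (fact assms conv assms(18)[OF elim(2)])+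
    then show ?case by (rule LIMSEQ_Suc)
  qed
qed

end
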